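(* For each n2-model $M_{\mathcal{N}} = \langle W, \mathcal{N}, V_{\mathcal{N}} \rangle$ there exists a t2d-model $M_{t} = \langle W, \mathfrak{W}, V_{t} \rangle$ (on the same set $W$) which is pointwise equivalent to $M_{\mathcal{N}}$, i.e. for every formula $\varphi$ and every $w \in W$: $w \Vdash \varphi$ in $M_{\mathcal{N}}$ if and only if $w \in V_{t}(\varphi)$.
   Context: Language: $PV$ is a fixed denumerable set of propositional variables; formulas are built from propositional variables and $\bot$ using $\land, \lor, \rightarrow$ and the unary operator $\Box$ ($\lnot\varphi$ abbreviates $\varphi \rightarrow \bot$). Complements are written $-A = W \setminus A$. An n2-frame is an ordered pair $\langle W, \mathcal{N} \rangle$ where $W$ is a non-empty set and $\mathcal{N}$ is a function from $W$ into $P(P(W))$ (write $\mathcal{N}_w$ for $\mathcal{N}(w)$) such that, for all $w,u,v \in W$ and $X \subseteq W$: (a) $w \in \bigcap \mathcal{N}_{w}$; (b) $\bigcap \mathcal{N}_{w} \in \mathcal{N}_{w}$; (c) if $u \in \bigcap \mathcal{N}_{w}$ then $\bigcap \mathcal{N}_{u} \subseteq \bigcap \mathcal{N}_{w}$; (d) if $X \subseteq \bigcup \mathcal{N}_{w}$ and $\bigcap \mathcal{N}_{w} \subseteq X$ then $X \in \mathcal{N}_{w}$; (e) if $u \in \bigcap \mathcal{N}_{w}$ then $\bigcup \mathcal{N}_{u} \subseteq \bigcup \mathcal{N}_{w}$; (f) if $v \in \bigcup \mathcal{N}_{w}$ then $\bigcap \mathcal{N}_{v} \subseteq \bigcup \mathcal{N}_{w}$.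 An n2-model is a triple $\langle W, \mathcal{N}, V_{\mathcal{N}} \rangle$ where $\langle W, \mathcal{N} \rangle$ is an n2-frame and $V_{\mathcal{N}} : PV \to P(W)$ satisfies: if $w \in V_{\mathcal{N}}(q)$ then $\bigcap \mathcal{N}_{w} \subseteq V_{\mathcal{N}}(q)$. Forcing in an n2-model is defined inductively: $w \nVdash \bot$; $w \Vdash q \Leftrightarrow w \in V_{\mathcal{N}}(q)$ for $q \in PV$; $w \Vdash \varphi \lor \psi \Leftrightarrow w \Vdash \varphi$ or $w \Vdash \psi$; $w \Vdash \varphi \land \psi \Leftrightarrow w \Vdash \varphi$ and $w \Vdash \psi$; $w \Vdash \varphi \rightarrow \psi \Leftrightarrow \bigcap \mathcal{N}_{w} \subseteq \{v \in W : v \nVdash \varphi \text{ or } v \Vdash \psi\}$; $w \Vdash \Box \varphi \Leftrightarrow \bigcup \mathcal{N}_{w} \subseteq \{v \in W : v \Vdash \varphi\}$. A t2d-model (multi-topological model with distinguished sets) is a triple $\langle W, \mathfrak{W}, V_{t} \rangle$ where: $W \neq \emptyset$; $\mathfrak{W}$ is a collection of triples $\langle T, \tau, D^{T} \rangle$ with $T \subseteq W$, $\tau$ a topology on $T$, and $D^{T} \in \tau$, $D^{T} \neq \emptyset$; every $w \in W$ belongs to $T$ for some $\langle T, \tau, D^{T} \rangle \in \mathfrak{W}$; and $V_{t} : PV \to P(W)$ is such that each $V_{t}(q)$ is a union of some family of sets each of which belongs to $\tau$ for at least one $\langle T, \tau, D^{T} \rangle \in \mathfrak{W}$. The valuation is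 extended to all formulas inductively: $V_{t}(\bot) = \emptyset$; $V_{t}(\varphi \land \psi) = V_{t}(\varphi) \cap V_{t}(\psi)$; $V_{t}(\varphi \lor \psi) = V_{t}(\varphi) \cup V_{t}(\psi)$; $V_{t}(\varphi \rightarrow \psi) = \bigcup_{\langle T, \tau, D^T\rangle \in \mathfrak{W}} \mathrm{Int}_{\tau}\left(T \setminus (V_{t}(\varphi) \cap -V_{t}(\psi))\right)$, where $\mathrm{Int}_\tau$ is the interior in $\langle T,\tau\rangle$; $V_{t}(\Box \varphi) = \bigcup \{ D^{T} : \langle T, \tau, D^{T} \rangle \in \mathfrak{W},\ T \subseteq V_{t}(\varphi)\}$. *)

theory Defs
  imports
    "HOL-Analysis.Abstract_Topology"
    "HOL-Library.Countable"
    "HOL-Library.Infinite_Typeclass"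
begin

text \<open>The set of propositional variables is the universe of the type \<open>'p\<close>; that it is
  denumerable is expressed by the sort \<open>{countable, infinite}\<close> where results are stated.\<close>

datatype 'p fm =
    Var 'p
  | Falsum
  | Conj "'p fm" "'p fm"
  | Disj "'p fm" "'p fm"
  | Impl "'p fm" "'p fm"
  | Box "'p fm"

abbreviation Neg :: "'p fm \<Rightarrow> 'p fm" where
  "Neg \<phi> \<equiv> Impl \<phi> Falsum"

text \<open>Only the values of \<open>N\<close> on \<open>W\<close> matter. The convention
  \<open>\<Inter>{} = UNIV\<close> is harmless, since \<open>n2_b\<close> excludes \<open>N w = {}\<close>.\<close>

locale n2_frame =
  fixes W :: "'a set" and N :: "'a \<Rightarrow> 'a set set"
  assumes W_nonempty: "W \<noteq> {}"
    and N_Pow: "w \<in> W \<Longrightarrow> N w \<subseteq> Pow W"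
    and n2_a: "w \<in> W \<Longrightarrow> w \<in> \<Inter>(N w)"
    and n2_b: "w \<in> W \<Longrightarrow> \<Inter>(N w) \<in> N w"
    and n2_c: "w \<in> W \<Longrightarrow> u \<in> W \<Longrightarrow> u \<in> \<Inter>(N w) \<Longrightarrow> \<Inter>(N u) \<subseteq> \<Inter>(N w)"
    and n2_d: "w \<in> W \<Longrightarrow> X \<subseteq> W \<Longrightarrow> X \<subseteq> \<Union>(N w) \<Longrightarrow> \<Inter>(N w) \<subseteq> X \<Longrightarrow> X \<in> N w"
    and n2_e: "w \<in> W \<Longrightarrow> u \<in> W \<Longrightarrow> u \<in> \<Inter>(N w) \<Longrightarrow> \<Union>(N u) \<subseteq> \<Union>(N w)"
    and n2_f: "w \<in> W \<Longrightarrow> v \<in> W \<Longrightarrow> v \<in> \<Union>(N w) \<Longrightarrow> \<Inter>(N v) \<subseteq> \<Union>(N w)"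

locale n2_model = n2_frame W N
  for W :: "'a set" and N :: "'a \<Rightarrow> 'a set set" +
  fixes V :: "'p \<Rightarrow> 'a set"
  assumes V_subset: "V q \<subseteq> W"
    and V_persistent: "w \<in> V q \<Longrightarrow> \<Inter>(N w) \<subseteq> V q"

primrec n2_forces ::
  "'a set \<Rightarrow> ('a \<Rightarrow> 'a set set) \<Rightarrow> ('p \<Rightarrow> 'a set) \<Rightarrow> 'a \<Rightarrow> 'p fm \<Rightarrow> bool"
where
  "n2_forces W N V w (Var q) \<longleftrightarrow> w \<in> V q"
| "n2_forces W N V w Falsum \<longleftrightarrow> False"
| "n2_forces W N V w (Conj \<phi> \<psi>) \<longleftrightarrow> n2_forces W N V w \<phi> \<and> n2_forces W N V w \<psi>"
| "n2_forces W N V w (Disj \<phi> \<psi>) \<longleftrightarrow> n2_forces W N V w \<phi> \<or> n2_forces W N V w \<psi>"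
| "n2_forces W N V w (Impl \<phi> \<psi>) \<longleftrightarrow>
     \<Inter>(N w) \<subseteq> {v \<in> W. \<not> n2_forces W N V v \<phi> \<or> n2_forces W N V v \<psi>}"
| "n2_forces W N V w (Box \<phi>) \<longleftrightarrow> \<Union>(N w) \<subseteq> {v \<in> W. n2_forces W N V v \<phi>}"

text \<open>The collection \<open>\<WW>\<close> consists of triples \<open>(T, \<tau>, D)\<close>; that \<open>\<tau>\<close>
  is a topology on \<open>T\<close> is the condition \<open>topspace \<tau> = T\<close>.\<close>

locale t2d_model =
  fixes W :: "'a set"
    and \<WW> :: "('a set \<times> 'a topology \<times> 'a set) set"
    and V :: "'p \<Rightarrow> 'a set"
  assumes W_nonempty: "W \<noteq> {}"
    and T_subset: "(T, \<tau>, D) \<in> \<WW> \<Longrightarrow> T \<subseteq> W"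
    and topology_on: "(T, \<tau>, D) \<in> \<WW> \<Longrightarrow> topspace \<tau> = T"
    and D_open: "(T, \<tau>, D) \<in> \<WW> \<Longrightarrow> openin \<tau> D"
    and D_nonempty: "(T, \<tau>, D) \<in> \<WW> \<Longrightarrow> D \<noteq> {}"
    and covering: "w \<in> W \<Longrightarrow> \<exists>(T, \<tau>, D)\<in>\<WW>. w \<in> T"
    and V_subset: "V q \<subseteq> W"
    and V_union: "\<exists>\<F>. (\<forall>U\<in>\<F>. \<exists>(T, \<tau>, D)\<in>\<WW>. openin \<tau> U) \<and> V q = \<Union>\<F>"

primrec t2d_val ::
  "'a set \<Rightarrow> ('a set \<times> 'a topology \<times> 'a set) set \<Rightarrow> ('p \<Rightarrow> 'a set) \<Rightarrow> 'p fm \<Rightarrow> 'a set"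
where
  "t2d_val W \<WW> V (Var q) = V q"
| "t2d_val W \<WW> V Falsum = {}"
| "t2d_val W \<WW> V (Conj \<phi> \<psi>) = t2d_val W \<WW> V \<phi> \<inter> t2d_val W \<WW> V \<psi>"
| "t2d_val W \<WW> V (Disj \<phi> \<psi>) = t2d_val W \<WW> V \<phi> \<union> t2d_val W \<WW> V \<psi>"
| "t2d_val W \<WW> V (Impl \<phi> \<psi>) =
     (\<Union>(T, \<tau>, D)\<in>\<WW>. \<tau> interior_of (T - (t2d_val W \<WW> V \<phi> \<inter> (W - t2d_val W \<WW> V \<psi>))))"
| "t2d_val W \<WW> V (Box \<phi>) = \<Union>{D. \<exists>T \<tau>. (T, \<tau>, D) \<in> \<WW> \<and> T \<subseteq> t2d_val W \<WW> V \<phi>}"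

end

theory Submission
  imports Defs
begin

text \<open>
  At every world \<open>w\<close> put the space on the maximal neighbourhood \<open>\<Union>(N w)\<close> whose open
  sets are its subsets that contain \<open>\<Inter>(N v)\<close> together with each of their points \<open>v\<close>, and
  distinguish the minimal neighbourhood \<open>\<Inter>(N w)\<close>. The valuation of the variables is kept.

  The openness condition does not depend on \<open>w\<close>, and this is what makes the two semantics
  agree although the clauses of the topological one are unions over all spaces. An open set
  of \<^emph>\<open>any\<close> of the spaces that contains \<open>w\<close> also contains \<open>\<Inter>(N w)\<close>, while
  \<open>\<Inter>(N w)\<close> is itself open in the space at \<open>w\<close>; hence \<open>w\<close> is in some interior of a
  set exactly when \<open>\<Inter>(N w)\<close> is included in it, which settles implication. For the
  modality, if \<open>w\<close> is in the distinguished set at \<open>u\<close>, then \<open>n2_e\<close> makes the space at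
  \<open>w\<close> a part of the space at \<open>u\<close>, so the space at \<open>w\<close> is already a witness.
\<close>

definition closed_under :: "('a \<Rightarrow> 'a set) \<Rightarrow> 'a set \<Rightarrow> bool" where
  "closed_under c X \<longleftrightarrow> (\<forall>v\<in>X. c v \<subseteq> X)"

text \<open>When \<open>c v\<close> is the set of points above \<open>v\<close> in a preorder, this is the Alexandrov
  topology of its restriction to \<open>T\<close>, provided that \<open>T\<close> is an up-set.\<close>

definition alexandrov_topology :: "('a \<Rightarrow> 'a set) \<Rightarrow> 'a set \<Rightarrow> 'a topology" where
  "alexandrov_topology c T = topology (\<lambda>X. X \<subseteq> T \<and> closed_under c X)"

lemma openin_alexandrov_topology:
  "openin (alexandrov_topology c T) X \<longleftrightarrow> X \<subseteq> T \<and> closed_under c X"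
proof -
  have "istopology (\<lambda>X. X \<subseteq> T \<and> closed_under c X)"
    unfolding istopology_def closed_under_def by blast
  then show ?thesis
    by (simp add: alexandrov_topology_def topology_inverse')
qed

lemma topspace_alexandrov_topology:
  assumes "closed_under c T"
  shows "topspace (alexandrov_topology c T) = T"
  using assms unfolding topspace_def openin_alexandrov_topology by blast

context n2_frame
begin

definition minimal_nbhd :: "'a \<Rightarrow> 'a set" where
  "minimal_nbhd w = \<Inter>(N w)"

definition maximal_nbhd :: "'a \<Rightarrow> 'a set" where
  "maximal_nbhd w = \<Union>(N w)"

definition nbhd_spaces :: "('a set \<times> 'a topology \<times> 'a set) set" where
  "nbhd_spaces =
     (\<lambda>w. (maximal_nbhd w, alexandrov_topology minimal_nbhd (maximal_nbhd w), minimal_nbhd w)) ` W"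

lemma mem_minimal_nbhd: "w \<in> W \<Longrightarrow> w \<in> minimal_nbhd w"
  using n2_a by (simp add: minimal_nbhd_def)

lemma minimal_nbhd_subset_maximal: "w \<in> W \<Longrightarrow> minimal_nbhd w \<subseteq> maximal_nbhd w"
  using n2_b unfolding minimal_nbhd_def maximal_nbhd_def by blast

lemma maximal_nbhd_subset: "w \<in> W \<Longrightarrow> maximal_nbhd w \<subseteq> W"
  using N_Pow unfolding maximal_nbhd_def by blast

lemma minimal_nbhd_subset: "w \<in> W \<Longrightarrow> minimal_nbhd w \<subseteq> W"
  using minimal_nbhd_subset_maximal maximal_nbhd_subset by blast

lemma closed_under_minimal_nbhd: "w \<in> W \<Longrightarrow> closed_under minimal_nbhd (minimal_nbhd w)"
  using n2_c minimal_nbhd_subset unfolding closed_under_def minimal_nbhd_def by blast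

lemma closed_under_maximal_nbhd: "w \<in> W \<Longrightarrow> closed_under minimal_nbhd (maximal_nbhd w)"
  using n2_f maximal_nbhd_subset unfolding closed_under_def minimal_nbhd_def maximal_nbhd_def
  by blast

lemma openin_minimal_nbhd:
  "w \<in> W \<Longrightarrow> openin (alexandrov_topology minimal_nbhd (maximal_nbhd w)) (minimal_nbhd w)"
  by (simp add: openin_alexandrov_topology minimal_nbhd_subset_maximal closed_under_minimal_nbhd)

text \<open>Every open neighbourhood of \<open>w\<close>, in whatever space, contains \<open>minimal_nbhd w\<close>, and
  this set is open in the space at \<open>w\<close>. The union over all spaces in the clause for
  implication therefore adds nothing to what the space at \<open>w\<close> gives.\<close>

lemma mem_interior_nbhd_spaces_iff:
  assumes "w \<in> W"
  shows "(\<exists>u\<in>W. w \<in> alexandrov_topology minimal_nbhd (maximal_nbhd u)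
                       interior_of (maximal_nbhd u \<inter> A)) \<longleftrightarrow> minimal_nbhd w \<subseteq> A"
proof
  assume "\<exists>u\<in>W. w \<in> alexandrov_topology minimal_nbhd (maximal_nbhd u)
                       interior_of (maximal_nbhd u \<inter> A)"
  then obtain X where "closed_under minimal_nbhd X" "w \<in> X" "X \<subseteq> A"
    unfolding interior_of_def openin_alexandrov_topology by blast
  then show "minimal_nbhd w \<subseteq> A"
    unfolding closed_under_def by blast
next
  assume "minimal_nbhd w \<subseteq> A"
  then have "minimal_nbhd w \<subseteq> alexandrov_topology minimal_nbhd (maximal_nbhd w)
                                  interior_of (maximal_nbhd w \<inter> A)"
    using assms openin_minimal_nbhd minimal_nbhd_subset_maximal
    by (intro interior_of_maximal) auto
  then show "\<exists>u\<in>W. w \<in> alexandrov_topology minimal_nbhd (maximal_nbhd u)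
                         interior_of (maximal_nbhd u \<inter> A)"
    using assms mem_minimal_nbhd by blast
qed

text \<open>Here \<open>n2_e\<close> enters: passing from \<open>u\<close> to a point of its minimal neighbourhood can only
  shrink the maximal neighbourhood.\<close>

lemma mem_distinguished_iff:
  assumes "w \<in> W"
  shows "(\<exists>u\<in>W. w \<in> minimal_nbhd u \<and> maximal_nbhd u \<subseteq> A) \<longleftrightarrow> maximal_nbhd w \<subseteq> A"
proof -
  have "maximal_nbhd w \<subseteq> maximal_nbhd u" if "u \<in> W" "w \<in> minimal_nbhd u" for u
    using n2_e[OF that(1) assms] that(2) by (simp add: minimal_nbhd_def maximal_nbhd_def)
  then show ?thesis
    using assms mem_minimal_nbhd by blast
qed

end

context n2_model
begin

lemma t2d_model_nbhd_spaces: "t2d_model W nbhd_spaces V"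
proof
  show "W \<noteq> {}" by (rule W_nonempty)
next
  fix T \<tau> D
  assume "(T, \<tau>, D) \<in> nbhd_spaces"
  then obtain w where w: "w \<in> W" and T: "T = maximal_nbhd w"
    and \<tau>: "\<tau> = alexandrov_topology minimal_nbhd (maximal_nbhd w)" and D: "D = minimal_nbhd w"
    unfolding nbhd_spaces_def by blast
  show "T \<subseteq> W" using w T maximal_nbhd_subset by blast
  show "topspace \<tau> = T"
    using w T \<tau> by (simp add: topspace_alexandrov_topology closed_under_maximal_nbhd)
  show "openin \<tau> D" using w \<tau> D by (simp add: openin_minimal_nbhd)
  show "D \<noteq> {}" using w D mem_minimal_nbhd by blast
next
  fix w assume "w \<in> W"
  then show "\<exists>(T, \<tau>, D)\<in>nbhd_spaces. w \<in> T"
    unfolding nbhd_spaces_def using mem_minimal_nbhd minimal_nbhd_subset_maximal by blast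
next
  fix q
  show "V q \<subseteq> W" by (rule V_subset)
  \<comment> \<open>Persistence makes \<open>V q\<close> the union of the minimal neighbourhoods of its points.\<close>
  have "V q = \<Union>(minimal_nbhd ` V q)"
  proof
    show "V q \<subseteq> \<Union>(minimal_nbhd ` V q)"
      using V_subset mem_minimal_nbhd by blast
    show "\<Union>(minimal_nbhd ` V q) \<subseteq> V q"
      using V_persistent by (simp add: UN_subset_iff minimal_nbhd_def)
  qed
  moreover have "\<forall>U\<in>minimal_nbhd ` V q. \<exists>(T, \<tau>, D)\<in>nbhd_spaces. openin \<tau> U"
    unfolding nbhd_spaces_def using V_subset openin_minimal_nbhd by blast
  ultimately show "\<exists>\<F>. (\<forall>U\<in>\<F>. \<exists>(T, \<tau>, D)\<in>nbhd_spaces. openin \<tau> U) \<and> V q = \<Union>\<F>"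
    by blast
qed

lemma forces_iff_mem_t2d_val:
  "w \<in> W \<Longrightarrow> n2_forces W N V w \<phi> \<longleftrightarrow> w \<in> t2d_val W nbhd_spaces V \<phi>"
proof (induction \<phi> arbitrary: w)
  case (Impl \<phi> \<psi>)
  define A where "A = {v \<in> W. \<not> n2_forces W N V v \<phi> \<or> n2_forces W N V v \<psi>}"
  have A: "maximal_nbhd u - (t2d_val W nbhd_spaces V \<phi> \<inter> (W - t2d_val W nbhd_spaces V \<psi>))
             = maximal_nbhd u \<inter> A" if "u \<in> W" for u
    using Impl.IH maximal_nbhd_subset[OF that] unfolding A_def by blast
  have "n2_forces W N V w (Impl \<phi> \<psi>) \<longleftrightarrow> minimal_nbhd w \<subseteq> A"
    by (simp add: A_def minimal_nbhd_def)
  also have "\<dots> \<longleftrightarrow> (\<exists>u\<in>W. w \<in> alexandrov_topology minimal_nbhd (maximal_nbhd u)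
                                        interior_of (maximal_nbhd u \<inter> A))"
    by (rule mem_interior_nbhd_spaces_iff[OF Impl.prems, symmetric])
  also have "\<dots> \<longleftrightarrow> w \<in> t2d_val W nbhd_spaces V (Impl \<phi> \<psi>)"
    using A by (simp add: nbhd_spaces_def)
  finally show ?case .
next
  case (Box \<phi>)
  have "n2_forces W N V w (Box \<phi>) \<longleftrightarrow> maximal_nbhd w \<subseteq> t2d_val W nbhd_spaces V \<phi>"
    using Box.IH maximal_nbhd_subset[OF Box.prems] by (auto simp: maximal_nbhd_def)
  also have "\<dots> \<longleftrightarrow>
      (\<exists>u\<in>W. w \<in> minimal_nbhd u \<and> maximal_nbhd u \<subseteq> t2d_val W nbhd_spaces V \<phi>)"
    by (rule mem_distinguished_iff[OF Box.prems, symmetric])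
  also have "\<dots> \<longleftrightarrow> w \<in> \<Union>{D. \<exists>T \<tau>. (T, \<tau>, D) \<in> nbhd_spaces \<and> T \<subseteq> t2d_val W nbhd_spaces V \<phi>}"
    by (auto simp: nbhd_spaces_def)
  finally show ?case by simp
qed simp_all

end

theorem theorem6p3:
  fixes W :: "'a set" and N :: "'a \<Rightarrow> 'a set set"
    and V\<^sub>N :: "'p :: {countable, infinite} \<Rightarrow> 'a set"
  assumes "n2_model W N V\<^sub>N"
  shows "\<exists>(\<WW> :: ('a set \<times> 'a topology \<times> 'a set) set) (V\<^sub>t :: 'p \<Rightarrow> 'a set).
           t2d_model W \<WW> V\<^sub>t \<and>
           (\<forall>(\<phi> :: 'p fm). \<forall>w\<in>W. n2_forces W N V\<^sub>N w \<phi> \<longleftrightarrow> w \<in> t2d_val W \<WW> V\<^sub>t \<phi>)"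
proof -
  interpret n2_model W N V\<^sub>N by (rule assms)
  show ?thesis
    by (intro exI conjI allI ballI) (rule t2d_model_nbhd_spaces, rule forces_iff_mem_t2d_val)
qed

end
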